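(* The radius-$1$ flip-width of the gem and of the co-gem are at most $2$.
   Context: All graphs are finite, simple. For $A,B\subseteq V(G)$, $G\oplus(A,B)$ is the graph on $V(G)$ in which the adjacency of distinct $u,v$ is toggled exactly when $(u,v)\in(A\times B)\cup(B\times A)$; $G\oplus\mathcal{S}$ applies all flips in a collection $\mathcal{S}$. For a partition $\mathcal{P}$ of $V(G)$, a $\mathcal{P}$-flip is $G\oplus\mathcal{S}$ with all pairs in $\mathcal{S}$ of the form $(X,Y)$, $X,Y\in\mathcal{P}$; a $k$-flip is a $\mathcal{P}$-flip with $|\mathcal{P}|\le k$. Flipper game of radius $r$ and width $k$: $G_0=G$, the runner picks $v_0$; in round $i\ge1$ the flipper announces a $k$-flip $G_i$ of $G$, then the runner (knowing $G_i$) moves to $v_i$ reachable from $v_{i-1}$ by a path of length at most $r$ in $G_{i-1}$. The flipper wins when the runner's position $v_i$ is isolated in $G_i$. The radius-$r$ flip-width is the minimum $k$ such that the flipper has a winning strategy. With $abcd$ an induced path and a fifth vertex $v$: the gem has $v$ adjacent to all of $a,b,c,d$; the co-gem has $v$ isolated. *)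

theory Defs
  imports "Graph_Theory.Graph_Theory" "HOL-Library.Disjoint_Sets"
begin

text \<open>
  A finite simple graph is a \<^locale>\<open>pair_graph\<close>: a finite vertex set together with a symmetric,
  irreflexive set of arcs, so that an edge is stored as both ordered pairs of its ends.
\<close>

definition flip :: "'a set \<Rightarrow> 'a set \<Rightarrow> 'a pair_pre_digraph \<Rightarrow> 'a pair_pre_digraph" where
  "flip A B G = \<lparr> pverts = pverts G,
     parcs = {(u, v). u \<in> pverts G \<and> v \<in> pverts G \<and> u \<noteq> v \<and>
                ((u, v) \<in> parcs G \<longleftrightarrow> (u, v) \<notin> A \<times> B \<union> B \<times> A)} \<rparr>"

text \<open>The order of the list is immaterial, by \<open>flip_commute\<close> below.\<close>

definition flips :: "('a set \<times> 'a set) list \<Rightarrow> 'a pair_pre_digraph \<Rightarrow> 'a pair_pre_digraph" where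
  "flips S G = fold (\<lambda>(A, B). flip A B) S G"

definition partition_flip ::
  "'a set set \<Rightarrow> 'a pair_pre_digraph \<Rightarrow> 'a pair_pre_digraph \<Rightarrow> bool" where
  "partition_flip P G H \<longleftrightarrow> (\<exists>S. set S \<subseteq> P \<times> P \<and> H = flips S G)"

definition k_flip :: "nat \<Rightarrow> 'a pair_pre_digraph \<Rightarrow> 'a pair_pre_digraph \<Rightarrow> bool" where
  "k_flip k G H \<longleftrightarrow>
     (\<exists>P. partition_on (pverts G) P \<and> finite P \<and> card P \<le> k \<and> partition_flip P G H)"

definition within_distance :: "nat \<Rightarrow> 'a pair_pre_digraph \<Rightarrow> 'a \<Rightarrow> 'a \<Rightarrow> bool" where
  "within_distance r G u v \<longleftrightarrow> (\<exists>p. pre_digraph.apath (with_proj G) u p v \<and> length p \<le> r)"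

definition isolated :: "'a pair_pre_digraph \<Rightarrow> 'a \<Rightarrow> bool" where
  "isolated G v \<longleftrightarrow> v \<in> pverts G \<and> (\<forall>u. (v, u) \<notin> parcs G)"

text \<open>
  A strategy of the flipper maps the runner's positions \<open>v\<^sub>0, \<dots>, v\<^sub>i\<^sub>-\<^sub>1\<close> so far to the graph
  \<open>G\<^sub>i\<close> announced in round \<open>i \<ge> 1\<close>; the flipper's own earlier announcements are determined by
  these positions. \<open>announced \<sigma> G v i\<close> is \<open>G\<^sub>i\<close>, with \<open>G\<^sub>0 = G\<close>.
\<close>

type_synonym 'a flipper_strategy = "'a list \<Rightarrow> 'a pair_pre_digraph"

definition announced ::
  "'a flipper_strategy \<Rightarrow> 'a pair_pre_digraph \<Rightarrow> (nat \<Rightarrow> 'a) \<Rightarrow> nat \<Rightarrow> 'a pair_pre_digraph" where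
  "announced \<sigma> G v i = (if i = 0 then G else \<sigma> (map v [0..<i]))"

text \<open>
  The game ends once the runner is isolated. As the runner may always stay in place (the empty
  path), every play can be prolonged to an infinite sequence of moves, and the flipper wins a play
  iff the winning condition holds at some index of this sequence.
\<close>

definition runner_play ::
  "nat \<Rightarrow> 'a flipper_strategy \<Rightarrow> 'a pair_pre_digraph \<Rightarrow> (nat \<Rightarrow> 'a) \<Rightarrow> bool" where
  "runner_play r \<sigma> G v \<longleftrightarrow>
     v 0 \<in> pverts G \<and> (\<forall>i. within_distance r (announced \<sigma> G v i) (v i) (v (Suc i)))"

definition winning_strategy ::
  "nat \<Rightarrow> nat \<Rightarrow> 'a pair_pre_digraph \<Rightarrow> 'a flipper_strategy \<Rightarrow> bool" where
  "winning_strategy r k G \<sigma> \<longleftrightarrow>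
     (\<forall>h. k_flip k G (\<sigma> h)) \<and>
     (\<forall>v. runner_play r \<sigma> G v \<longrightarrow> (\<exists>i. isolated (announced \<sigma> G v i) (v i)))"

text \<open>For a finite simple graph the minimum exists, by \<open>winning_strategy_exists\<close> below.\<close>

definition flip_width :: "nat \<Rightarrow> 'a pair_pre_digraph \<Rightarrow> nat" where
  "flip_width r G = (LEAST k. \<exists>\<sigma>. winning_strategy r k G \<sigma>)"

definition gem :: "'a \<Rightarrow> 'a \<Rightarrow> 'a \<Rightarrow> 'a \<Rightarrow> 'a \<Rightarrow> 'a pair_pre_digraph" where
  "gem a b c d v = (let E = {(a, b), (b, c), (c, d), (v, a), (v, b), (v, c), (v, d)} in
     \<lparr> pverts = {a, b, c, d, v}, parcs = E \<union> E\<inverse> \<rparr>)"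

definition co_gem :: "'a \<Rightarrow> 'a \<Rightarrow> 'a \<Rightarrow> 'a \<Rightarrow> 'a \<Rightarrow> 'a pair_pre_digraph" where
  "co_gem a b c d v = (let E = {(a, b), (b, c), (c, d)} in
     \<lparr> pverts = {a, b, c, d, v}, parcs = E \<union> E\<inverse> \<rparr>)"

lemma pair_graph_gem: "distinct [a, b, c, d, v] \<Longrightarrow> pair_graph (gem a b c d v)"
  by unfold_locales (auto simp: gem_def Let_def symmetric_def sym_def)

lemma pair_graph_co_gem: "distinct [a, b, c, d, v] \<Longrightarrow> pair_graph (co_gem a b c d v)"
  by unfold_locales (auto simp: co_gem_def Let_def symmetric_def sym_def)

lemma flip_commute: "flip A B (flip C D G) = flip C D (flip A B G)"
  unfolding flip_def by auto

lemma pair_graph_flip: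
  assumes "pair_graph G"
  shows "pair_graph (flip A B G)"
proof -
  interpret pair_graph G by fact
  have s: "sym (parcs G)"
    using pair_sym_arcs by (simp add: symmetric_def)
  have "parcs (flip A B G) \<subseteq> pverts G \<times> pverts G"
    by (auto simp: flip_def)
  then have f: "finite (parcs (flip A B G))"
    by (rule finite_subset) (simp add: pair_finite_verts)
  show ?thesis
    by unfold_locales
      (use f s pair_finite_verts in \<open>auto simp: flip_def symmetric_def sym_def\<close>)
qed

lemma flips_to_edgeless:
  assumes "pair_graph G"
  shows "\<exists>S. set S \<subseteq> (\<lambda>x. {x}) ` pverts G \<times> (\<lambda>x. {x}) ` pverts G \<and>
             flips S G = \<lparr> pverts = pverts G, parcs = {} \<rparr>"
  using assms
proof (induction "card (parcs G)" arbitrary: G rule: less_induct)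
  case less
  interpret pair_graph G by fact
  show ?case
  proof (cases "parcs G = {}")
    case True
    then have "flips [] G = \<lparr> pverts = pverts G, parcs = {} \<rparr>"
      by (simp add: flips_def)
    then show ?thesis
      by (intro exI[of _ "[]"]) simp
  next
    case False
    then obtain x y where xy: "(x, y) \<in> parcs G" by auto
    let ?H = "flip {x} {y} G"
    have yx: "(y, x) \<in> parcs G"
      using xy pair_sym_arcs by (auto simp: symmetric_def sym_def)
    have "parcs ?H \<subseteq> parcs G - {(x, y)}"
      using xy yx by (auto simp: flip_def)
    then have "parcs ?H \<subset> parcs G" using xy by auto
    then have "card (parcs ?H) < card (parcs G)"
      by (rule psubset_card_mono[OF pair_finite_arcs])
    then obtain S where S: "set S \<subseteq> (\<lambda>x. {x}) ` pverts ?H \<times> (\<lambda>x. {x}) ` pverts ?H"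
      "flips S ?H = \<lparr> pverts = pverts ?H, parcs = {} \<rparr>"
      using less.hyps[OF _ pair_graph_flip[OF less.prems]] by blast
    have "x \<in> pverts G" "y \<in> pverts G"
      using xy in_arcsD1 in_arcsD2 by auto
    then show ?thesis
      using S by (intro exI[of _ "({x}, {y}) # S"]) (auto simp: flips_def flip_def)
  qed
qed

lemma winning_strategy_exists:
  assumes "pair_graph G"
  shows "\<exists>k \<sigma>. winning_strategy r k G \<sigma>"
proof -
  interpret pair_graph G by fact
  let ?E = "\<lparr> pverts = pverts G, parcs = {} \<rparr>"
  let ?P = "(\<lambda>x. {x}) ` pverts G"
  have "partition_on (pverts G) ?P"
    by (auto simp: partition_on_def disjoint_def)
  moreover have "finite ?P" using pair_finite_verts by simp
  moreover have "partition_flip ?P G ?E"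
    using flips_to_edgeless[OF assms] unfolding partition_flip_def by metis
  ultimately have k: "k_flip (card ?P) G ?E"
    unfolding k_flip_def by blast
  have "\<exists>i. isolated (announced (\<lambda>h. ?E) G v i) (v i)" if "runner_play r (\<lambda>h. ?E) G v" for v
  proof -
    have "within_distance r G (v 0) (v 1)"
      using that unfolding runner_play_def announced_def by (metis One_nat_def)
    then have "v 1 \<in> pverts G"
      unfolding within_distance_def by (auto dest!: awalkI_apath awalk_last_in_verts)
    then have "isolated (announced (\<lambda>h. ?E) G v 1) (v 1)"
      by (simp add: isolated_def announced_def)
    then show ?thesis by blast
  qed
  then have "winning_strategy r (card ?P) G (\<lambda>h. ?E)"
    using k unfolding winning_strategy_def by blast
  then show ?thesis by blast
qed

end

theory Submission
  imports Defs
begin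

text \<open>
  The flipper wins without looking at the runner, by announcing six fixed 2-flips of the co-gem that
  confine the runner to a shrinking set of vertices. The gem is the complement
  of a co-gem whose induced path visits the same vertices in another order, and flipping every pair
  of parts of a 2-partition complements a graph. Hence the 2-flips of that co-gem are also 2-flips of
  the gem, and its announcements win there too.
\<close>

text \<open>
  In \<open>sweeps r R Ks\<close> the set \<open>R\<close> contains the possible positions of the runner at the moment when
  the first graph of \<open>Ks\<close> takes effect; by the end of \<open>Ks\<close> the runner has been caught.
\<close>

inductive sweeps :: "nat \<Rightarrow> 'a set \<Rightarrow> 'a pair_pre_digraph list \<Rightarrow> bool" for r where
  Nil: "sweeps r {} []"
| Cons: "(\<And>u w. u \<in> R \<Longrightarrow> \<not> isolated K u \<Longrightarrow> within_distance r K u w \<Longrightarrow> w \<in> R') \<Longrightarrow>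
    sweeps r R' Ks \<Longrightarrow> sweeps r R (K # Ks)"

text \<open>A runner that is never isolated would stay inside the successive sets of
  \<open>sweeps\<close>, the last of which is empty. The induction shifts the play by one
  move.\<close>

lemma sweeps_isolated:
  assumes "sweeps r R Ks" "v 0 \<in> R"
    "\<And>i. i < length Ks \<Longrightarrow> within_distance r (Ks ! i) (v i) (v (Suc i))"
  shows "\<exists>i<length Ks. isolated (Ks ! i) (v i)"
  using assms
proof (induction arbitrary: v)
  case Nil
  then show ?case by simp
next
  case (Cons R K R' Ks)
  show ?case
  proof (cases "isolated K (v 0)")
    case True
    then show ?thesis by (intro exI[of _ 0]) simp
  next
    case False
    have "v (Suc 0) \<in> R'"
      using Cons.hyps(1)[OF Cons.prems(1) False] Cons.prems(2)[of 0] by simp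
    moreover have "within_distance r (Ks ! i) (v (Suc i)) (v (Suc (Suc i)))"
      if "i < length Ks" for i
      using Cons.prems(2)[of "Suc i"] that by simp
    ultimately obtain i where "i < length Ks" "isolated (Ks ! i) (v (Suc i))"
      using Cons.IH[of "\<lambda>i. v (Suc i)"] by blast
    then show ?thesis by (intro exI[of _ "Suc i"]) simp
  qed
qed

lemma within_distance_in_pverts:
  assumes "pair_graph G" "within_distance r G u w"
  shows "w \<in> pverts G"
proof -
  interpret pair_graph G by fact
  show ?thesis
    using assms(2) unfolding within_distance_def
    by (auto dest!: awalkI_apath awalk_last_in_verts)
qed

lemma within_distance_1: "within_distance 1 G u w \<Longrightarrow> w = u \<or> (u, w) \<in> parcs G"
  unfolding within_distance_def pre_digraph.apath_def pre_digraph.awalk_def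
  by (auto simp: le_Suc_eq length_Suc_conv pre_digraph.cas.simps)

lemma flip_width_le_if_sweeps:
  assumes "pair_graph G" and sweeps: "sweeps r (pverts G) Ks" and "Ks \<noteq> []"
    and k_flip: "\<And>K. K \<in> set Ks \<Longrightarrow> k_flip k G K"
  shows "flip_width r G \<le> k"
proof -
  \<comment> \<open>In round \<open>i\<close> the history has length \<open>i\<close>, hence the
    shift by one. The cap repeats the last graph once \<open>Ks\<close> is exhausted, so that every
    announcement is a k-flip.\<close>
  define \<sigma> where "\<sigma> h = Ks ! min (length h - 1) (length Ks - 1)" for h :: "'a list"
  have announced: "announced \<sigma> G v (Suc i) = Ks ! i" if "i < length Ks" for v i
    using that by (simp add: announced_def \<sigma>_def min_def)
  have "\<exists>i. isolated (announced \<sigma> G v i) (v i)" if play: "runner_play r \<sigma> G v" for v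
  proof -
    have move: "within_distance r (announced \<sigma> G v i) (v i) (v (Suc i))" for i
      using play by (simp add: runner_play_def)
    \<comment> \<open>The first move runs along \<open>G\<close> itself, before any announcement
      takes effect. It may end at any vertex as far as the argument knows, so the sweep starts from
      all of \<open>pverts G\<close>.\<close>
    have "v (Suc 0) \<in> pverts G"
      using move[of 0] within_distance_in_pverts[OF \<open>pair_graph G\<close>]
      by (auto simp: announced_def)
    moreover have "within_distance r (Ks ! i) (v (Suc i)) (v (Suc (Suc i)))"
      if "i < length Ks" for i
      using move[of "Suc i"] announced[OF that] by simp
    ultimately obtain i where "i < length Ks" "isolated (Ks ! i) (v (Suc i))"
      using sweeps_isolated[OF sweeps, of "\<lambda>i. v (Suc i)"] by blast
    then show ?thesis using announced by metis
  qed
  moreover have "k_flip k G (\<sigma> h)" for h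
    using \<open>Ks \<noteq> []\<close> unfolding \<sigma>_def by (intro k_flip nth_mem) (cases Ks; simp)
  ultimately have "winning_strategy r k G \<sigma>"
    by (simp add: winning_strategy_def)
  then show ?thesis
    unfolding flip_width_def by (intro Least_le) blast
qed

lemma k_flip_2I:
  assumes "A \<noteq> {}" "A \<subset> pverts G"
    and "set S \<subseteq> {A, pverts G - A} \<times> {A, pverts G - A}"
  shows "k_flip 2 G (flips S G)"
  unfolding k_flip_def partition_flip_def
proof (intro exI conjI)
  show "partition_on (pverts G) {A, pverts G - A}"
    using assms(1,2) by (auto simp: partition_on_def disjoint_def)
  show "card {A, pverts G - A} \<le> 2"
    by (simp add: card_insert_if)
qed (use assms(3) in auto)

text \<open>Each pair of distinct vertices is toggled by exactly one of the three flips. As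
  \<open>flip\<close> is symmetric in its two sets, a further \<open>(B, A)\<close> would undo
  \<open>(A, B)\<close>.\<close>

lemma flips_complement:
  assumes "A \<subseteq> pverts G"
  defines "B \<equiv> pverts G - A"
  shows "flips [(A, A), (A, B), (B, B)] G =
    \<lparr> pverts = pverts G,
      parcs = {(u, v). u \<in> pverts G \<and> v \<in> pverts G \<and> u \<noteq> v \<and> (u, v) \<notin> parcs G} \<rparr>"
  using assms by (auto simp: flips_def flip_def)

lemma pverts_gem: "pverts (gem a b c d v) = {a, b, c, d, v}"
  and pverts_co_gem: "pverts (co_gem a b c d v) = {a, b, c, d, v}"
  by (simp_all add: gem_def co_gem_def Let_def)

text \<open>The path \<open>abcd\<close> is the complement of the path \<open>cadb\<close>.\<close>

lemma k_flip_2_gem: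
  assumes distinct: "distinct [a, b, c, d, v]"
    and A: "A \<noteq> {}" "A \<subset> {a, b, c, d, v}"
    and S: "set S \<subseteq> {A, {a, b, c, d, v} - A} \<times> {A, {a, b, c, d, v} - A}"
  shows "k_flip 2 (gem c a d b v) (flips S (co_gem a b c d v))"
proof -
  let ?V = "{a, b, c, d, v}" and ?G = "gem c a d b v" and ?P = "co_gem a b c d v"
  let ?C = "[(A, A), (A, ?V - A), (?V - A, ?V - A)]"
  have pverts: "pverts ?G = ?V" by (auto simp: pverts_gem)
  have "\<forall>x\<in>?V. \<forall>y\<in>?V. (x, y) \<in> parcs ?P \<longleftrightarrow> x \<noteq> y \<and> (x, y) \<notin> parcs ?G"
    using distinct by (simp add: gem_def co_gem_def Let_def eq_commute)
  moreover have "parcs ?P \<subseteq> ?V \<times> ?V"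
    by (auto simp: co_gem_def Let_def)
  ultimately have parcs:
    "parcs ?P = {(x, y). x \<in> ?V \<and> y \<in> ?V \<and> x \<noteq> y \<and> (x, y) \<notin> parcs ?G}"
    by blast
  have "flips ?C ?G = \<lparr>pverts = ?V, parcs = parcs ?P\<rparr>"
    using flips_complement[of A ?G] A(2) unfolding pverts parcs by blast
  also have "\<dots> = ?P"
    by (simp add: co_gem_def Let_def)
  finally have "flips ?C ?G = ?P" .
  \<comment> \<open>Complementing first uses the same two parts, so the width stays 2.\<close>
  then have "flips S ?P = flips (?C @ S) ?G"
    by (simp add: flips_def)
  moreover have "k_flip 2 ?G (flips (?C @ S) ?G)"
    using A S by (intro k_flip_2I[of A]) (auto simp only: pverts set_append list.set)
  ultimately show ?thesis by simp
qed

text \<open>One sequence of flips of the co-gem serves both games: after the first move only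
  announced graphs constrain the runner.\<close>

lemma flip_width_1_le_2:
  assumes distinct: "distinct [a, b, c, d, v]"
    and G: "pair_graph G" "pverts G = {a, b, c, d, v}"
    and k_flip: "\<And>A S. A \<noteq> {} \<Longrightarrow> A \<subset> {a, b, c, d, v} \<Longrightarrow>
      set S \<subseteq> {A, {a, b, c, d, v} - A} \<times> {A, {a, b, c, d, v} - A} \<Longrightarrow>
      k_flip 2 G (flips S (co_gem a b c d v))"
  shows "flip_width 1 G \<le> 2"
proof -
  let ?V = "{a, b, c, d, v}" and ?P = "co_gem a b c d v"
  define graph :: "('a \<times> 'a) set \<Rightarrow> 'a pair_pre_digraph"
    where "graph E = \<lparr> pverts = ?V, parcs = E \<union> E\<inverse> \<rparr>" for E
  \<comment> \<open>Edges of six single flips of the co-gem, in order of announcement: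
    \<open>?E2\<close> and \<open>?E5\<close> toggle between the two parts, the others inside one
    part.\<close>
  let ?E1 = "{(a, c), (c, d)}" and ?E2 = "{(a, d), (b, v), (d, v)}" and ?E3 = "{(b, c), (c, d)}"
    and ?E4 = "{(a, b), (b, c)}" and ?E5 = "{(a, d), (a, v), (c, v)}" and ?E6 = "{(a, b), (b, d)}"
  have neq: "a \<noteq> b" "a \<noteq> c" "a \<noteq> d" "a \<noteq> v" "b \<noteq> c" "b \<noteq> d" "b \<noteq> v" "c \<noteq> d" "c \<noteq> v" "d \<noteq> v"
    using distinct by simp_all
  note neq = neq neq[symmetric]
  \<comment> \<open>\<open>x\<close> and \<open>w\<close> witness that \<open>A\<close> is a
    nonempty proper subset. The bounded quantifiers let simplification decide the edges pair by
    pair.\<close>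
  have k_flip_graph: "k_flip 2 G (graph E)"
    if "x \<in> A" "A \<subseteq> ?V" "w \<in> ?V" "w \<notin> A" "B = A \<or> B = ?V - A" "E \<subseteq> ?V \<times> ?V"
      and "\<forall>x\<in>?V. \<forall>y\<in>?V. (x, y) \<in> E \<union> E\<inverse> \<longleftrightarrow>
        x \<noteq> y \<and> ((x, y) \<in> parcs ?P \<longleftrightarrow> (x, y) \<notin> A \<times> B \<union> B \<times> A)"
    for x w A B E
  proof -
    have "graph E = flips [(A, B)] ?P"
      using that(6,7) unfolding graph_def flips_def flip_def
      by (simp add: pverts_co_gem del: insert_iff ball_simps) blast
    moreover have "A \<noteq> {}" "A \<subset> ?V" using that(1-4) by blast+
    ultimately show ?thesis
      using k_flip[of A "[(A, B)]"] that(5) by auto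
  qed
  note parcs = co_gem_def Let_def
  have "k_flip 2 G (graph ?E1)"
    by (rule k_flip_graph[of a "{a, b, c}" d "{a, b, c}"]) (use neq in \<open>simp_all add: parcs\<close>)
  moreover have "k_flip 2 G (graph ?E2)"
    by (rule k_flip_graph[of b "{b, d}" a "?V - {b, d}"]) (use neq in \<open>simp_all add: parcs\<close>)
  moreover have "k_flip 2 G (graph ?E3)"
    by (rule k_flip_graph[of a "{a, b}" c "{a, b}"]) (use neq in \<open>simp_all add: parcs\<close>)
  moreover have "k_flip 2 G (graph ?E4)"
    by (rule k_flip_graph[of c "{c, d}" a "{c, d}"]) (use neq in \<open>simp_all add: parcs\<close>)
  moreover have "k_flip 2 G (graph ?E5)"
    by (rule k_flip_graph[of a "{a, c}" b "?V - {a, c}"]) (use neq in \<open>simp_all add: parcs\<close>)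
  moreover have "k_flip 2 G (graph ?E6)"
    by (rule k_flip_graph[of b "{b, c, d}" a "{b, c, d}"]) (use neq in \<open>simp_all add: parcs\<close>)
  moreover have "sweeps 1 ?V (map graph [?E1, ?E2, ?E3, ?E4, ?E5, ?E6])"
  proof -
    \<comment> \<open>Either \<open>u\<close> is isolated and the runner is caught there, or
      \<open>R'\<close> must contain the neighbours of \<open>u\<close> and also \<open>u\<close>,
      as the runner may stay.\<close>
    have step: "sweeps 1 R (graph E # Ks)"
      if "sweeps 1 R' Ks" "R \<subseteq> ?V" "E \<subseteq> ?V \<times> ?V"
        and "\<forall>u\<in>R. (\<forall>w\<in>?V. (u, w) \<notin> E \<union> E\<inverse>) \<or>
          u \<in> R' \<and> (\<forall>w\<in>?V. (u, w) \<in> E \<union> E\<inverse> \<longrightarrow> w \<in> R')"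
      for R R' E Ks
    proof (rule sweeps.Cons[OF _ that(1)])
      fix u w
      assume u: "u \<in> R" "\<not> isolated (graph E) u" and w: "within_distance 1 (graph E) u w"
      from u that(2,3) have "\<exists>w\<in>?V. (u, w) \<in> E \<union> E\<inverse>"
        unfolding isolated_def graph_def pair_pre_digraph.simps by blast
      then have *: "u \<in> R' \<and> (\<forall>w\<in>?V. (u, w) \<in> E \<union> E\<inverse> \<longrightarrow> w \<in> R')"
        using that(4) u(1) by blast
      have "w = u \<or> (u, w) \<in> E \<union> E\<inverse>"
        using within_distance_1[OF w] unfolding graph_def pair_pre_digraph.simps .
      then show "w \<in> R'"
        using * that(3) by blast
    qed
    \<comment> \<open>Built backwards from the last graph. In order of play the runner is confined
      to \<open>?V\<close>, \<open>{a, c, d}\<close>, \<open>{a, d, v}\<close>,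
      \<open>{c, d}\<close>, \<open>{b, c}\<close>, \<open>{c, v}\<close>; both \<open>c\<close> and
      \<open>v\<close> are isolated in \<open>graph ?E6\<close>.\<close>
    have "sweeps 1 {c, v} (map graph [?E6])"
      unfolding list.map by (rule step[OF sweeps.Nil]) (use neq in simp_all)
    then have "sweeps 1 {b, c} (map graph [?E5, ?E6])"
      unfolding list.map by (rule step) (use neq in simp_all)
    then have "sweeps 1 {c, d} (map graph [?E4, ?E5, ?E6])"
      unfolding list.map by (rule step) (use neq in simp_all)
    then have "sweeps 1 {a, d, v} (map graph [?E3, ?E4, ?E5, ?E6])"
      unfolding list.map by (rule step) (use neq in simp_all)
    then have "sweeps 1 {a, c, d} (map graph [?E2, ?E3, ?E4, ?E5, ?E6])"
      unfolding list.map by (rule step) (use neq in simp_all)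
    then show ?thesis
      unfolding list.map by (rule step) (use neq in simp_all)
  qed
  ultimately show ?thesis
    using flip_width_le_if_sweeps[of G 1 "map graph [?E1, ?E2, ?E3, ?E4, ?E5, ?E6]" 2]
    unfolding list.map using G by force
qed

theorem theorem5p1:
  fixes a b c d v :: 'a
  assumes "distinct [a, b, c, d, v]"
  shows "flip_width 1 (gem a b c d v) \<le> 2 \<and> flip_width 1 (co_gem a b c d v) \<le> 2"
proof
  \<comment> \<open>Substituting \<open>b, d, a, c\<close> for \<open>a, b, c, d\<close> turns the
    path \<open>cadb\<close> of \<open>k_flip_2_gem\<close> into \<open>abcd\<close>.\<close>
  have bdacv: "distinct [b, d, a, c, v]" using assms by auto
  have "pverts (gem a b c d v) = {b, d, a, c, v}" by (auto simp: pverts_gem)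
  then show "flip_width 1 (gem a b c d v) \<le> 2"
    by (rule flip_width_1_le_2[OF bdacv pair_graph_gem[OF assms] _ k_flip_2_gem[OF bdacv]])
  show "flip_width 1 (co_gem a b c d v) \<le> 2"
    by (rule flip_width_1_le_2[OF assms pair_graph_co_gem[OF assms] pverts_co_gem k_flip_2I])
      (simp_all add: pverts_co_gem)
qed

end
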